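(* Let $\mathbf{x}$ be an infinite word over a finite alphabet $\Sigma$. If $\mathbf{x}$ is not ultimately periodic, then $$\lim_{n \to \infty} \frac{\operatorname{Pal}_{\mathbf{x}}(n)\,\log(\operatorname{Pal}_{\mathbf{x}}(n)+1)}{\rho_{\mathbf{x}}(n)} = 0.$$
   Context: An infinite word $\mathbf{x} = (a_i)_{i\ge 0}$ over a finite alphabet $\Sigma$ is a sequence of elements of $\Sigma$ indexed by the nonnegative integers. It is ultimately periodic if there are $T\ge 1$ and $N\ge 0$ with $a_{i+T}=a_i$ for all $i\ge N$. A length-$n$ factor of $\mathbf{x}$ is a finite word of the form $a_i a_{i+1}\cdots a_{i+n-1}$ for some $i\ge 0$. The factor complexity $\rho_{\mathbf{x}}(n)$ is the number of distinct length-$n$ factors of $\mathbf{x}$. A finite word is a palindrome if it equals its reversal. The palindrome complexity $\operatorname{Pal}_{\mathbf{x}}(n)$ is the number of distinct length-$n$ factors of $\mathbf{x}$ that are palindromes. Here $\log$ is the natural logarithm. *)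

theory Defs
  imports Complex_Main
begin

definition ultimately_periodic :: "(nat \<Rightarrow> 'a) \<Rightarrow> bool" where
  "ultimately_periodic x \<longleftrightarrow> (\<exists>T\<ge>1. \<exists>N. \<forall>i\<ge>N. x (i + T) = x i)"

definition factors :: "(nat \<Rightarrow> 'a) \<Rightarrow> nat \<Rightarrow> 'a list set" where
  "factors x n = {map x [i..<i + n] | i. True}"

definition palindrome :: "'a list \<Rightarrow> bool" where
  "palindrome w \<longleftrightarrow> rev w = w"

(* For a word over a finite alphabet, factors x n is finite, so card below is the true count. *)

definition factor_complexity :: "(nat \<Rightarrow> 'a) \<Rightarrow> nat \<Rightarrow> nat" where
  "factor_complexity x n = card (factors x n)"

definition palindrome_complexity :: "(nat \<Rightarrow> 'a) \<Rightarrow> nat \<Rightarrow> nat" where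
  "palindrome_complexity x n = card {w \<in> factors x n. palindrome w}"

end

theory Submission
  imports Defs "HOL-Real_Asymp.Real_Asymp"
begin

text \<open>
  Write \<open>\<rho>\<close> and \<open>P\<close> for the factor and palindrome complexity of \<open>x\<close>. The heart of the proof
  is the inequality \<open>q * P n \<le> \<rho> n + q ^ 3 * \<rho> (2 * q)\<close>, valid for all \<open>n\<close> and \<open>q\<close>
  (lemma \<open>palindrome_complexity_bound\<close>). If \<open>2 * q > n\<close>, its last term
  already bounds the left-hand side. Otherwise fix one occurrence of every palindromic factor \<open>u\<close>
  of length \<open>n\<close> and slide a window of length \<open>n\<close> to the right of it by \<open>j = 0, ..., q - 1\<close>. If all
  these windows were different words, then \<open>q * P n \<le> \<rho> n\<close>. Windows with the same shift are
  different, because a palindrome is determined by its last \<open>n - j\<close> letters. If the windows of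
  \<open>u\<close> and \<open>v\<close> with shifts \<open>j < j'\<close> agree, then the common word has palindromic prefixes of
  lengths \<open>n - 2 * j\<close> and \<open>n - 2 * j'\<close>; composing the two reflections shows that \<open>u\<close> without
  its \<open>j\<close> outer letters on each side has period \<open>2 * (j' - j)\<close>. Such a \<open>u\<close> is determined by
  \<open>j\<close>, \<open>j'\<close> and its prefix of length \<open>2 * q\<close>, so there are at most \<open>q\<^sup>2 * \<rho> (2 * q)\<close> of them;
  the windows of the remaining palindromes are pairwise different.

  The limit follows from a case distinction on the entropy \<open>h = inf (ln (\<rho> m) / m)\<close>. If
  \<open>h > 0\<close>, then \<open>\<rho> n\<close> is \<open>exp (h * n + o(n))\<close>, whereas a palindrome is determined by one half
  of itself, so \<open>P n\<close> is at most \<open>exp (h * n / 2 + o(n))\<close> and the quotient decays exponentially.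
  If \<open>h = 0\<close>, then \<open>\<rho> m \<le> C * exp (\<epsilon> * m)\<close> for every \<open>\<epsilon> > 0\<close>. The inequality with \<open>q\<close> close
  to \<open>ln (\<rho> n) / (4 * \<epsilon>)\<close> has \<open>\<rho> (2 * q) \<le> C * sqrt (\<rho> n)\<close>, so its second term is dominated by
  the first one as soon as \<open>\<rho> n\<close> is large, and \<open>q * P n \<le> 2 * \<rho> n\<close>. Since \<open>ln (P n + 1)\<close> is at
  most of order \<open>\<epsilon> * q\<close>, the quotient is of order \<open>\<epsilon>\<close>. Aperiodicity enters through
  \<open>\<rho> n \<longlonglongrightarrow> \<infinity>\<close> (lemma \<open>factor_complexity_at_top\<close>).
\<close>

section \<open>Factors and factor complexity\<close>

lemma length_factor: "w \<in> factors x n \<Longrightarrow> length w = n"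
  by (auto simp: factors_def)

lemma window_in_factors: "map x [i..<i + n] \<in> factors x n"
  by (auto simp: factors_def)

lemma take_in_factors:
  assumes "w \<in> factors x n" and "m \<le> n"
  shows "take m w \<in> factors x m"
proof -
  from assms(1) obtain i where "w = map x [i..<i + n]" by (auto simp: factors_def)
  then have "take m w = map x [i..<i + m]" using assms(2) by (simp add: take_map)
  then show ?thesis by (simp add: window_in_factors)
qed

lemma drop_in_factors:
  assumes "w \<in> factors x (m + n)"
  shows "drop m w \<in> factors x n"
proof -
  from assms obtain i where "w = map x [i..<i + (m + n)]" by (auto simp: factors_def)
  then have "drop m w = map x [i + m..<i + m + n]" by (simp add: drop_map add.assoc)
  then show ?thesis by (simp add: window_in_factors)
qed

lemma finite_factors:
  assumes "finite (range x)"
  shows "finite (factors x n)"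
proof (rule finite_subset)
  show "factors x n \<subseteq> {w. set w \<subseteq> range x \<and> length w = n}"
    by (auto simp: factors_def)
  show "finite {w. set w \<subseteq> range x \<and> length w = n}"
    by (rule finite_lists_length_eq[OF assms])
qed

lemma factor_complexity_pos:
  assumes "finite (range x)"
  shows "factor_complexity x n > 0"
  using finite_factors[OF assms] window_in_factors[of x 0 n]
  by (auto simp: factor_complexity_def card_gt_0_iff)

lemma factor_complexity_mono:
  assumes "finite (range x)" and "m \<le> n"
  shows "factor_complexity x m \<le> factor_complexity x n"
proof -
  have "factors x m \<subseteq> take m ` factors x n"
  proof
    fix w assume "w \<in> factors x m"
    then obtain i where "w = map x [i..<i + m]" by (auto simp: factors_def)
    then have "w = take m (map x [i..<i + n])" using assms(2) by (simp add: take_map)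
    then show "w \<in> take m ` factors x n" using window_in_factors by blast
  qed
  then show ?thesis
    unfolding factor_complexity_def
    by (rule surj_card_le[OF finite_factors[OF assms(1)]])
qed

lemma factor_complexity_add:
  assumes "finite (range x)"
  shows "factor_complexity x (m + n) \<le> factor_complexity x m * factor_complexity x n"
proof -
  have "card (factors x (m + n)) \<le> card (factors x m \<times> factors x n)"
  proof (rule card_inj_on_le)
    show "inj_on (\<lambda>w. (take m w, drop m w)) (factors x (m + n))"
      by (rule inj_onI) (metis append_take_drop_id prod.inject)
    show "(\<lambda>w. (take m w, drop m w)) ` factors x (m + n) \<subseteq> factors x m \<times> factors x n"
      using take_in_factors[of _ x "m + n" m] drop_in_factors[of _ x m n] by auto
    show "finite (factors x m \<times> factors x n)"
      using finite_factors[OF assms] by blast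
  qed
  then show ?thesis by (simp add: factor_complexity_def card_cartesian_product)
qed

lemma factor_complexity_mult:
  assumes "finite (range x)"
  shows "factor_complexity x (k * m) \<le> factor_complexity x m ^ k"
proof (induction k)
  case 0
  have "factors x 0 = {[]}" by (auto simp: factors_def)
  then show ?case by (simp add: factor_complexity_def)
next
  case (Suc k)
  have "factor_complexity x (Suc k * m) \<le> factor_complexity x m * factor_complexity x (k * m)"
    using factor_complexity_add[OF assms, of m "k * m"] by simp
  also have "\<dots> \<le> factor_complexity x m * factor_complexity x m ^ k"
    using Suc by simp
  finally show ?case by simp
qed

text \<open>When \<open>x\<close> is not ultimately periodic, its suffixes are pairwise distinct. Any \<open>b\<close> of them
  are then told apart by their prefixes of one common length, which gives \<open>b\<close> factors.\<close>

lemma factor_complexity_at_top: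
  assumes "finite (range x)" and "\<not> ultimately_periodic x"
  shows "filterlim (factor_complexity x) at_top sequentially"
proof (unfold filterlim_at_top eventually_sequentially, intro allI)
  fix b :: nat
  have "\<exists>t. x (i + t) \<noteq> x (j + t)" if "i < j" for i j
  proof (rule ccontr)
    assume "\<nexists>t. x (i + t) \<noteq> x (j + t)"
    then have eq: "x (i + t) = x (j + t)" for t by auto
    have "x (s + (j - i)) = x s" if "s \<ge> i" for s
      using eq[of "s - i"] that \<open>i < j\<close> by (simp add: add.commute)
    then have "ultimately_periodic x"
      unfolding ultimately_periodic_def using \<open>i < j\<close> by (intro exI[of _ "j - i"]) auto
    with assms(2) show False by contradiction
  qed
  then obtain t where t: "\<And>i j. i < j \<Longrightarrow> x (i + t i j) \<noteq> x (j + t i j)" by metis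
  define N where "N = Suc (Max (case_prod t ` ({..<b} \<times> {..<b})))"
  have N: "t i j < N" if "i < b" "j < b" for i j
    unfolding N_def less_Suc_eq_le using that by (intro Max_ge) auto
  have diff: "map x [i..<i + N] \<noteq> map x [j..<j + N]" if "i < j" "j < b" for i j
  proof
    assume "map x [i..<i + N] = map x [j..<j + N]"
    then have "map x [i..<i + N] ! t i j = map x [j..<j + N] ! t i j" by simp
    with t[OF that(1)] N[of i j] that show False by simp
  qed
  have "inj_on (\<lambda>i. map x [i..<i + N]) {..<b}"
  proof (rule inj_onI)
    fix i j assume "i \<in> {..<b}" "j \<in> {..<b}" "map x [i..<i + N] = map x [j..<j + N]"
    then show "i = j" using diff[of i j] diff[of j i] by (cases i j rule: linorder_cases) auto
  qed
  then have "card {..<b} \<le> card (factors x N)"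
    by (rule card_inj_on_le) (auto simp: window_in_factors finite_factors[OF assms(1)])
  then have "b \<le> factor_complexity x N" by (simp add: factor_complexity_def)
  then show "\<exists>N. \<forall>n\<ge>N. b \<le> factor_complexity x n"
    using factor_complexity_mono[OF assms(1)] le_trans by blast
qed

text \<open>Fekete's argument for the submultiplicative sequence \<open>factor_complexity x\<close>: take for \<open>h\<close>
  the infimum of \<open>ln (factor_complexity x m) / m\<close>, the entropy of \<open>x\<close>, and compare a word of
  length \<open>n\<close> with a concatenation of blocks of one length \<open>m\<close> that nearly attains it.\<close>

lemma factor_complexity_entropy:
  assumes "finite (range x)"
  obtains h :: real where "h \<ge> 0"
    and "\<And>n. exp (h * n) \<le> factor_complexity x n"
    and "\<And>\<delta>. \<delta> > 0 \<Longrightarrow> \<exists>C\<ge>1. \<forall>n. factor_complexity x n \<le> C * exp ((h + \<delta>) * n)"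
proof -
  define L where "L n = ln (real (factor_complexity x n))" for n
  have pos: "real (factor_complexity x n) > 0" for n
    using factor_complexity_pos[OF assms, of n] by simp
  have L0: "L n \<ge> 0" for n
    using factor_complexity_pos[OF assms, of n] by (simp add: L_def)
  have exp_L: "exp (L n) = factor_complexity x n" for n
    using pos by (simp add: L_def)
  define h where "h = (INF m\<in>{1..}. L m / real m)"
  have bdd: "bdd_below ((\<lambda>m. L m / real m) ` {1..})"
    using L0 by (intro bdd_belowI[of _ 0]) auto
  have h0: "h \<ge> 0" unfolding h_def using L0 by (intro cINF_greatest) auto
  have lower: "h * n \<le> L n" for n
  proof (cases "n = 0")
    case False
    then have "h \<le> L n / n" unfolding h_def by (intro cINF_lower[OF bdd]) auto
    with False show ?thesis by (simp add: field_simps)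
  qed (simp add: L0)
  have upper: "\<exists>C\<ge>1. \<forall>n. factor_complexity x n \<le> C * exp ((h + \<delta>) * n)" if "\<delta> > 0" for \<delta> :: real
  proof -
    have "(INF m\<in>{1..}. L m / real m) < h + \<delta>" using that by (simp add: h_def)
    then obtain m where m: "m \<ge> 1" "L m / real m < h + \<delta>"
      by (subst (asm) cINF_less_iff[OF _ bdd]) auto
    then have Lm: "L m \<le> (h + \<delta>) * m" by (simp add: field_simps)
    have "factor_complexity x n \<le> exp ((h + \<delta>) * m) * exp ((h + \<delta>) * n)" for n
    proof -
      define k where "k = Suc (n div m)"
      have k: "n \<le> k * m" "k * m \<le> n + m"
        using m(1) dividend_less_div_times[of m n] by (simp_all add: k_def)
      have "factor_complexity x n \<le> factor_complexity x m ^ k"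
        using factor_complexity_mono[OF assms k(1)] factor_complexity_mult[OF assms, of k m]
        by linarith
      then have "real (factor_complexity x n) \<le> real (factor_complexity x m) ^ k"
        by (metis of_nat_le_iff of_nat_power)
      also have "\<dots> = exp (k * L m)" by (simp add: exp_L exp_of_nat_mult)
      also have "\<dots> \<le> exp ((h + \<delta>) * (k * m))"
        using mult_left_mono[OF Lm, of k] by (simp add: mult_ac)
      also have "\<dots> \<le> exp ((h + \<delta>) * (n + m))"
        using k(2) h0 that by (simp flip: of_nat_mult of_nat_add)
      finally show ?thesis by (simp add: exp_add[symmetric] algebra_simps)
    qed
    moreover have "exp ((h + \<delta>) * m) \<ge> 1" using h0 that by simp
    ultimately show ?thesis by blast
  qed
  show ?thesis
  proof (rule that[OF h0])
    show "exp (h * n) \<le> factor_complexity x n" for n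
      using lower[of n] by (simp flip: exp_L)
  qed (use upper in blast)
qed

section \<open>Palindromic factors\<close>

lemma palindrome_nth:
  assumes "palindrome w" and "s < length w"
  shows "w ! s = w ! (length w - 1 - s)"
  using assms rev_nth[of s w] by (simp add: palindrome_def)

lemma palindrome_complexity_le_factor_complexity:
  assumes "finite (range x)"
  shows "palindrome_complexity x n \<le> factor_complexity x n"
  unfolding palindrome_complexity_def factor_complexity_def
  using finite_factors[OF assms] by (intro card_mono) auto

lemma palindrome_complexity_le_half:
  assumes "finite (range x)"
  shows "palindrome_complexity x n \<le> factor_complexity x ((n + 1) div 2)"
  unfolding palindrome_complexity_def factor_complexity_def
proof (rule card_inj_on_le)
  let ?m = "(n + 1) div 2"
  show "inj_on (take ?m) {w \<in> factors x n. palindrome w}"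
  proof (rule inj_onI)
    fix u v
    assume u: "u \<in> {w \<in> factors x n. palindrome w}" and v: "v \<in> {w \<in> factors x n. palindrome w}"
      and eq: "take ?m u = take ?m v"
    have len: "length u = n" "length v = n" using u v length_factor by auto
    have half: "u ! s = v ! s" if "s < ?m" for s using eq that by (metis nth_take)
    show "u = v"
    proof (rule nth_equalityI)
      fix s assume s: "s < length u"
      show "u ! s = v ! s"
      proof (cases "s < ?m")
        case False
        then have "n - 1 - s < ?m" using s len by linarith
        then show ?thesis
          using half palindrome_nth[of u s] palindrome_nth[of v s] u v s len by simp
      qed (rule half)
    qed (simp add: len)
  qed
  show "take ?m ` {w \<in> factors x n. palindrome w} \<subseteq> factors x ?m"
    using take_in_factors[of _ x n ?m] by auto
  show "finite (factors x ?m)" by (rule finite_factors[OF assms])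
qed

text \<open>Period \<open>d\<close> is required only of what remains of \<open>u\<close> after removing \<open>j\<close> letters on each
  side.\<close>

definition centrally_periodic :: "nat \<Rightarrow> nat \<Rightarrow> 'a list \<Rightarrow> bool" where
  "centrally_periodic j d u \<longleftrightarrow> (\<forall>s\<ge>j. s + d < length u - j \<longrightarrow> u ! s = u ! (s + d))"

text \<open>The first \<open>j + d\<close> letters contain the left margin and one period of the middle part, which
  the period propagates; the right margin is the mirror image of the left one.\<close>

lemma centrally_periodic_palindrome_eqI:
  assumes "palindrome u" "palindrome v" "length u = n" "length v = n"
    and "centrally_periodic j d u" "centrally_periodic j d v"
    and "d > 0" "j + d \<le> m" "take m u = take m v"
  shows "u = v"
proof -
  have pre: "u ! s = v ! s" if "s < m" for s using assms(9) that by (metis nth_take)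
  have mid: "u ! s = v ! s" if "s < n - j" for s
    using that
  proof (induction s rule: less_induct)
    case (less s)
    show ?case
    proof (cases "s < m")
      case False
      then have s: "j \<le> s - d" "s - d + d = s" using assms(8) by auto
      have "u ! (s - d) = v ! (s - d)" using less assms(7) s by auto
      then show ?thesis
        using assms(3-6) s less.prems unfolding centrally_periodic_def by metis
    qed (rule pre)
  qed
  show ?thesis
  proof (rule nth_equalityI)
    fix s assume s: "s < length u"
    show "u ! s = v ! s"
    proof (cases "s < n - j")
      case False
      then have "n - 1 - s < m" using s assms(3,7,8) by linarith
      then show ?thesis
        using pre palindrome_nth[of u s] palindrome_nth[of v s] assms(1-4) s by simp
    qed (rule mid)
  qed (simp add: assms)
qed

text \<open>The window with shift \<open>j\<close> shows all but the first \<open>j\<close> letters of the palindrome, and these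
  are the mirror image of the last \<open>j\<close> letters, which the window shows when \<open>2 * j \<le> n\<close>.\<close>

lemma shifted_window_determines_palindrome:
  assumes "palindrome u" "palindrome v" "length u = n" "length v = n"
    and u: "\<And>s. s < n \<Longrightarrow> u ! s = x (a + s)" and v: "\<And>s. s < n \<Longrightarrow> v ! s = x (b + s)"
    and eq: "\<And>t. t < n \<Longrightarrow> x (a + j + t) = x (b + j + t)" and "2 * j \<le> n"
  shows "u = v"
proof -
  have right: "u ! s = v ! s" if "j \<le> s" "s < n" for s
    using eq[of "s - j"] u[of s] v[of s] that by simp
  show ?thesis
  proof (rule nth_equalityI)
    fix s assume s: "s < length u"
    show "u ! s = v ! s"
    proof (cases "j \<le> s")
      case False
      then have "j \<le> n - 1 - s" "n - 1 - s < n" using assms(3,8) s by auto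
      then show ?thesis
        using right palindrome_nth[of u s] palindrome_nth[of v s] assms(1-4) s by simp
    qed (use right s assms(3) in auto)
  qed (simp add: assms)
qed

text \<open>The common window \<open>w\<close> begins with the middle part of \<open>u\<close>, of length \<open>n - 2 * j\<close>, and with
  the middle part of \<open>v\<close>, of length \<open>n - 2 * j'\<close>. Both are palindromes. Their centres are
  \<open>j' - j\<close> apart, so the composition of the two reflections is a translation by twice that
  distance.\<close>

lemma colliding_windows_imp_centrally_periodic:
  assumes "palindrome u" "palindrome v" "length u = n" "length v = n"
    and u: "\<And>s. s < n \<Longrightarrow> u ! s = x (a + s)" and v: "\<And>s. s < n \<Longrightarrow> v ! s = x (b + s)"
    and eq: "\<And>t. t < n \<Longrightarrow> x (a + j + t) = x (b + j' + t)" and "j < j'"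
  shows "centrally_periodic j (2 * (j' - j)) u"
  unfolding centrally_periodic_def
proof (intro allI impI)
  fix s assume s: "s \<ge> j" "s + 2 * (j' - j) < length u - j"
  define w where "w t = x (a + j + t)" for t
  have refl_u: "w t = w (n - 2 * j - 1 - t)" if "t < n - 2 * j" for t
  proof -
    have "w t = u ! (j + t)" using u[of "j + t"] that by (simp add: w_def add.assoc)
    also have "\<dots> = u ! (n - 1 - (j + t))"
      using palindrome_nth[of u "j + t"] assms(1,3) that by simp
    also have "n - 1 - (j + t) = j + (n - 2 * j - 1 - t)" using that by simp
    also have "u ! \<dots> = w (n - 2 * j - 1 - t)"
      using u[of "j + (n - 2 * j - 1 - t)"] that by (simp add: w_def add.assoc)
    finally show ?thesis .
  qed
  have refl_v: "w t = w (n - 2 * j' - 1 - t)" if "t < n - 2 * j'" for t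
  proof -
    have w_v: "w t = x (b + j' + t)" if "t < n" for t using eq[OF that] by (simp add: w_def)
    have "w t = v ! (j' + t)" using v[of "j' + t"] w_v[of t] that by (simp add: add.assoc)
    also have "\<dots> = v ! (n - 1 - (j' + t))"
      using palindrome_nth[of v "j' + t"] assms(2,4) that by simp
    also have "n - 1 - (j' + t) = j' + (n - 2 * j' - 1 - t)" using that by simp
    also have "v ! \<dots> = w (n - 2 * j' - 1 - t)"
      using v[of "j' + (n - 2 * j' - 1 - t)"] w_v[of "n - 2 * j' - 1 - t"] that
      by (simp add: add.assoc)
    finally show ?thesis .
  qed
  (* Reflect in the centre of v, then in the centre of u. *)
  define t where "t = s - j"
  have t: "t < n - 2 * j'" "s = j + t" using s assms(3,8) by (auto simp: t_def)
  have "w t = w (n - 2 * j' - 1 - t)" by (rule refl_v[OF t(1)])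
  also have "\<dots> = w (n - 2 * j - 1 - (n - 2 * j' - 1 - t))"
    using t(1) assms(8) by (intro refl_u) linarith
  also have "n - 2 * j - 1 - (n - 2 * j' - 1 - t) = t + 2 * (j' - j)"
    using t(1) assms(8) by linarith
  finally have "w t = w (t + 2 * (j' - j))" .
  then show "u ! s = u ! (s + 2 * (j' - j))"
    using u[of s] u[of "s + 2 * (j' - j)"] s assms(3) t by (simp add: w_def add.assoc)
qed

text \<open>Double counting of the windows with shifts below \<open>q\<close>. When two windows with different
  shifts agree, only the palindrome with the smaller shift is shown to be centrally periodic; it
  is enough to discard that one for the others to have pairwise different windows.\<close>

lemma palindrome_complexity_bound:
  assumes fin: "finite (range x)"
  shows "q * palindrome_complexity x n \<le> factor_complexity x n + q ^ 3 * factor_complexity x (2 * q)"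
proof (cases "2 * q \<le> n")
  case False
  (* Here the second term alone bounds the left-hand side. *)
  have "palindrome_complexity x n \<le> factor_complexity x (2 * q)"
    using palindrome_complexity_le_factor_complexity[OF fin, of n]
      factor_complexity_mono[OF fin, of n "2 * q"] False by linarith
  then have "q * palindrome_complexity x n \<le> q ^ 3 * factor_complexity x (2 * q)"
    by (intro mult_mono) (simp_all add: power3_eq_cube)
  then show ?thesis by simp
next
  case q: True
  define P where "P = {w \<in> factors x n. palindrome w}"
  define B where "B j j' = {u \<in> P. centrally_periodic j (2 * (j' - j)) u}" for j j'
  define I where "I = {(j, j'). j < j' \<and> j' < q}"
  define Bad where "Bad = (\<Union>(j, j')\<in>I. B j j')"
  have finP: "finite P" using finite_factors[OF fin] by (simp add: P_def)
  have P: "palindrome u" "length u = n" if "u \<in> P" for u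
    using that length_factor by (auto simp: P_def)
  have "I \<subseteq> {..<q} \<times> {..<q}" by (auto simp: I_def)
  then have finI: "finite I" and "card I \<le> card ({..<q} \<times> {..<q})"
    using finite_subset[of I "{..<q} \<times> {..<q}"] card_mono[of "{..<q} \<times> {..<q}" I] by simp_all
  then have cardI: "card I \<le> q * q" by (simp add: card_cartesian_product)

  have cardB: "card (B j j') \<le> factor_complexity x (2 * q)" if "(j, j') \<in> I" for j j'
    unfolding factor_complexity_def
  proof (rule card_inj_on_le)
    have j: "j < j'" "j' < q" using that by (auto simp: I_def)
    show "inj_on (take (2 * q)) (B j j')"
    proof (rule inj_onI)
      fix u v assume uv: "u \<in> B j j'" "v \<in> B j j'" "take (2 * q) u = take (2 * q) v"
      show "u = v"
        by (rule centrally_periodic_palindrome_eqI[where n = n and j = j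
              and d = "2 * (j' - j)" and m = "2 * q"])
           (use uv j P in \<open>auto simp: B_def\<close>)
    qed
    show "take (2 * q) ` B j j' \<subseteq> factors x (2 * q)"
      using take_in_factors[OF _ q] by (auto simp: B_def P_def)
    show "finite (factors x (2 * q))" by (rule finite_factors[OF fin])
  qed
  have "card Bad \<le> (\<Sum>(j, j')\<in>I. card (B j j'))"
    unfolding Bad_def using card_UN_le[OF finI, of "\<lambda>(j, j'). B j j'"] by (simp add: case_prod_unfold)
  also have "\<dots> \<le> card I * factor_complexity x (2 * q)"
    using sum_bounded_above[of I "\<lambda>(j, j'). card (B j j')" "factor_complexity x (2 * q)"] cardB
    by (auto simp: case_prod_unfold)
  also have "\<dots> \<le> q * q * factor_complexity x (2 * q)" using cardI by simp
  finally have bad: "card Bad \<le> q * q * factor_complexity x (2 * q)" .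

  have "\<exists>a. u = map x [a..<a + n]" if "u \<in> P" for u
    using that by (auto simp: P_def factors_def)
  then obtain a where a: "\<And>u. u \<in> P \<Longrightarrow> u = map x [a u..<a u + n]" by metis
  have a_nth: "u ! s = x (a u + s)" if "u \<in> P" "s < n" for u s
    by (subst a[OF that(1)]) (use that in simp)
  have good: "card ((P - Bad) \<times> {..<q}) \<le> card (factors x n)"
  proof (rule card_inj_on_le)
    let ?w = "\<lambda>(u, j). map x [a u + j..<a u + j + n]"
    have eqD: "x (a u + j + t) = x (a v + j' + t)" if "?w (u, j) = ?w (v, j')" "t < n" for u v j j' t
      using arg_cong[OF that(1), of "\<lambda>w. w ! t"] that(2) by simp
    have no_collision: False
      if uv: "u \<in> P - Bad" "v \<in> P - Bad" "j < j'" "j' < q" and eq: "?w (u, j) = ?w (v, j')"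
      for u v j j'
    proof -
      have "centrally_periodic j (2 * (j' - j)) u"
        by (rule colliding_windows_imp_centrally_periodic[where v = v and x = x and n = n
              and a = "a u" and b = "a v"])
           (use uv P a_nth eqD[OF eq] in auto)
      then have "u \<in> Bad" using uv by (auto simp: Bad_def B_def I_def)
      with uv show False by simp
    qed
    show "inj_on ?w ((P - Bad) \<times> {..<q})"
    proof (rule inj_onI)
      fix z z'
      assume z: "z \<in> (P - Bad) \<times> {..<q}" "z' \<in> (P - Bad) \<times> {..<q}" "?w z = ?w z'"
      obtain u j v j' where zz': "z = (u, j)" "z' = (v, j')" by (cases z, cases z')
      have *: "?w (u, j) = ?w (v, j')" "u \<in> P" "u \<notin> Bad" "v \<in> P" "v \<notin> Bad"
        "j < q" "j' < q"
        using z unfolding zz' by blast+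
      have "j = j'"
        using no_collision[of u v j j'] no_collision[of v u j' j] * by (metis DiffI linorder_neqE_nat)
      moreover have "u = v"
        by (rule shifted_window_determines_palindrome[where x = x and n = n
              and a = "a u" and b = "a v" and j = j])
           (use * P a_nth eqD[OF *(1)] q \<open>j = j'\<close> in auto)
      ultimately show "z = z'" by (simp add: zz')
    qed
    show "?w ` ((P - Bad) \<times> {..<q}) \<subseteq> factors x n" using window_in_factors by auto
    show "finite (factors x n)" by (rule finite_factors[OF fin])
  qed
  have "Bad \<subseteq> P" by (auto simp: Bad_def B_def)
  then have "card P = card (P - Bad) + card Bad"
    using finP by (metis card_Diff_subset card_mono finite_subset le_add_diff_inverse2)
  then have "q * palindrome_complexity x n = card ((P - Bad) \<times> {..<q}) + q * card Bad"
    by (simp add: palindrome_complexity_def P_def card_cartesian_product algebra_simps)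
  also have "\<dots> \<le> factor_complexity x n + q * (q * q * factor_complexity x (2 * q))"
    using good mult_le_mono2[OF bad, of q] unfolding factor_complexity_def by linarith
  finally show ?thesis by (simp add: power3_eq_cube mult.assoc)
qed

section \<open>The limit\<close>

text \<open>Growth rate \<open>h + h / 2\<close> in the upper bound is small enough: over half the length it
  contributes the exponent \<open>3 / 4 * h * n\<close> for palindromes, still below \<open>h * n\<close>.\<close>

lemma limit_positive_entropy:
  assumes fin: "finite (range x)" and "h > 0"
    and lower: "\<And>n. exp (h * real n) \<le> factor_complexity x n"
    and upper: "\<And>n. factor_complexity x n \<le> C * exp ((h + h / 2) * real n)"
  shows "(\<lambda>n. real (palindrome_complexity x n) * ln (real (palindrome_complexity x n) + 1)
              / real (factor_complexity x n)) \<longlonglongrightarrow> 0"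
proof (rule tendsto_sandwich[OF _ _ tendsto_const])
  have C: "C > 0" using lower[of 0] upper[of 0] by simp
  define g where "g n = 3 / 4 * h * (real n + 1)" for n
  show "\<forall>\<^sub>F n in sequentially. real (palindrome_complexity x n) *
      ln (real (palindrome_complexity x n) + 1) / real (factor_complexity x n)
      \<le> C * exp (g n) * (ln (C + 1) + g n) / exp (h * n)"
  proof (rule always_eventually, rule allI)
    fix n
    let ?P = "real (palindrome_complexity x n)"
    have g: "g n \<ge> 0" using \<open>h > 0\<close> by (simp add: g_def)
    have "?P \<le> factor_complexity x ((n + 1) div 2)"
      using palindrome_complexity_le_half[OF fin, of n] by simp
    also have "\<dots> \<le> C * exp ((h + h / 2) * real ((n + 1) div 2))" by (rule upper)
    also have "\<dots> \<le> C * exp ((h + h / 2) * ((real n + 1) / 2))"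
    proof -
      have "real ((n + 1) div 2) \<le> (real n + 1) / 2"
        using of_nat_mono[of "2 * ((n + 1) div 2)" "n + 1", where 'a = real] by simp
      then have "(h + h / 2) * real ((n + 1) div 2) \<le> (h + h / 2) * ((real n + 1) / 2)"
        using \<open>h > 0\<close> by (intro mult_left_mono) auto
      then show ?thesis using C by simp
    qed
    also have "(h + h / 2) * ((real n + 1) / 2) = g n" by (simp add: g_def field_simps)
    finally have P: "?P \<le> C * exp (g n)" .
    have "?P + 1 \<le> (C + 1) * exp (g n)"
      using P g by (simp add: distrib_right add_mono)
    then have "ln (?P + 1) \<le> ln ((C + 1) * exp (g n))"
      by (intro ln_mono) (auto simp: add_pos_nonneg)
    also have "\<dots> = ln (C + 1) + g n" using C by (simp add: ln_mult)
    finally have l: "ln (?P + 1) \<le> ln (C + 1) + g n" .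
    show "?P * ln (?P + 1) / real (factor_complexity x n)
        \<le> C * exp (g n) * (ln (C + 1) + g n) / exp (h * n)"
      by (intro frac_le mult_mono P l lower) (use C g in auto)
  qed
  show "(\<lambda>n. C * exp (g n) * (ln (C + 1) + g n) / exp (h * n)) \<longlonglongrightarrow> 0"
    unfolding g_def using \<open>h > 0\<close> C by real_asymp
qed (auto intro!: always_eventually)

text \<open>The shift range \<open>q\<close> must be a large multiple of \<open>ln (factor_complexity x n)\<close> to beat the
  logarithm, yet \<open>factor_complexity x (2 * q)\<close> must stay well below \<open>factor_complexity x n\<close>.
  Subexponential growth makes both possible.\<close>

lemma limit_zero_entropy:
  assumes fin: "finite (range x)" and "\<not> ultimately_periodic x"
    and upper: "\<And>\<epsilon>. \<epsilon> > 0 \<Longrightarrow> \<exists>C\<ge>1. \<forall>n. factor_complexity x n \<le> C * exp (\<epsilon> * real n)"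
  shows "(\<lambda>n. real (palindrome_complexity x n) * ln (real (palindrome_complexity x n) + 1)
              / real (factor_complexity x n)) \<longlonglongrightarrow> 0"
proof (rule tendstoI)
  fix e :: real assume "e > 0"
  (* The estimates below end with the bound 32 * \<epsilon>, which has to be less than e. *)
  define \<epsilon> where "\<epsilon> = e / 64"
  have \<epsilon>: "\<epsilon> > 0" using \<open>e > 0\<close> by (simp add: \<epsilon>_def)
  obtain C where C: "C \<ge> 1" "\<And>n. factor_complexity x n \<le> C * exp (\<epsilon> * real n)"
    using upper[OF \<epsilon>] by blast
  have "\<forall>\<^sub>F r in at_top. C * (ln r / (4 * \<epsilon>)) ^ 3 * exp (ln r / 2) \<le> r \<and> 8 * \<epsilon> \<le> ln r \<and> r \<ge> 2"
    using C(1) \<epsilon> by (intro eventually_conj; real_asymp)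
  then have "\<forall>\<^sub>F n in sequentially.
      (\<lambda>r. C * (ln r / (4 * \<epsilon>)) ^ 3 * exp (ln r / 2) \<le> r \<and> 8 * \<epsilon> \<le> ln r \<and> r \<ge> 2)
        (real (factor_complexity x n))"
    by (rule eventually_compose_filterlim)
       (rule filterlim_compose[OF filterlim_real_sequentially
          factor_complexity_at_top[OF assms(1,2)]])
  then show "\<forall>\<^sub>F n in sequentially. dist (real (palindrome_complexity x n) *
      ln (real (palindrome_complexity x n) + 1) / real (factor_complexity x n)) 0 < e"
  proof eventually_elim
    case (elim n)
    define P where "P = real (palindrome_complexity x n)"
    define r where "r = real (factor_complexity x n)"
    have big: "C * (ln r / (4 * \<epsilon>)) ^ 3 * exp (ln r / 2) \<le> r" "8 * \<epsilon> \<le> ln r" "r \<ge> 2"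
      using elim by (auto simp: r_def)
    have P: "0 \<le> P" "P \<le> r"
      using palindrome_complexity_le_factor_complexity[OF fin, of n] by (auto simp: P_def r_def)
    define q where "q = nat \<lfloor>ln r / (4 * \<epsilon>)\<rfloor>"
    have ln_nonneg: "ln r / (4 * \<epsilon>) \<ge> 0" using big(3) \<epsilon> by simp
    have q_le: "real q \<le> ln r / (4 * \<epsilon>)" unfolding q_def using ln_nonneg by simp
    have "real q \<ge> ln r / (4 * \<epsilon>) - 1" unfolding q_def using ln_nonneg by linarith
    then have q_ge: "ln r \<le> 8 * \<epsilon> * q" using big(2) \<epsilon> by (simp add: field_simps)
    have "real (factor_complexity x (2 * q)) \<le> C * exp (\<epsilon> * real (2 * q))" by (rule C(2))
    also have "\<dots> \<le> C * exp (ln r / 2)" using q_le \<epsilon> C(1) by (simp add: field_simps)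
    finally have "real q ^ 3 * factor_complexity x (2 * q)
        \<le> (ln r / (4 * \<epsilon>)) ^ 3 * (C * exp (ln r / 2))"
      using q_le ln_nonneg by (intro mult_mono power_mono) auto
    also have "\<dots> \<le> r" using big(1) by (simp add: mult_ac)
    finally have qb: "real q ^ 3 * factor_complexity x (2 * q) \<le> r" .
    have "real (q * palindrome_complexity x n)
        \<le> real (factor_complexity x n + q ^ 3 * factor_complexity x (2 * q))"
      using palindrome_complexity_bound[OF fin] of_nat_le_iff by blast
    then have qP: "q * P \<le> 2 * r" using qb by (simp add: P_def r_def)
    have "P + 1 \<le> r * r" using P big(3) mult_right_mono[of 2 r r] by linarith
    then have "ln (P + 1) \<le> ln (r * r)" using P by (intro ln_mono) auto
    also have "\<dots> = 2 * ln r" using big(3) by (simp add: ln_mult)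
    also have "\<dots> \<le> 16 * \<epsilon> * q" using q_ge by simp
    finally have "P * ln (P + 1) \<le> P * (16 * \<epsilon> * q)" using P by (intro mult_left_mono)
    also have "\<dots> = 16 * \<epsilon> * (q * P)" by simp
    also have "\<dots> \<le> 16 * \<epsilon> * (2 * r)" using qP \<epsilon> by (intro mult_left_mono) auto
    also have "\<dots> < e * r" using big(3) \<open>e > 0\<close> by (simp add: \<epsilon>_def)
    finally have "P * ln (P + 1) / r < e" using big(3) by (simp add: field_simps)
    moreover have "P * ln (P + 1) / r \<ge> 0" using P big(3) by simp
    ultimately show ?case by (simp add: P_def r_def)
  qed
qed

theorem theorem4:
  fixes \<Sigma> :: "'a set" and x :: "nat \<Rightarrow> 'a"
  assumes "finite \<Sigma>"
    and "\<And>i. x i \<in> \<Sigma>"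
    and "\<not> ultimately_periodic x"
  shows "(\<lambda>n. real (palindrome_complexity x n) * ln (real (palindrome_complexity x n) + 1)
              / real (factor_complexity x n)) \<longlonglongrightarrow> 0"
proof -
  have fin: "finite (range x)" using assms(1,2) by (auto intro: finite_subset)
  obtain h :: real where h: "h \<ge> 0" "\<And>n. exp (h * n) \<le> factor_complexity x n"
    "\<And>\<delta>. \<delta> > 0 \<Longrightarrow> \<exists>C\<ge>1. \<forall>n. factor_complexity x n \<le> C * exp ((h + \<delta>) * n)"
    using factor_complexity_entropy[OF fin] by blast
  show ?thesis
  proof (cases "h = 0")
    case True
    then show ?thesis using limit_zero_entropy[OF fin assms(3)] h(3) by simp
  next
    case False
    with h(1) have "h > 0" by simp
    then obtain C where "\<And>n. factor_complexity x n \<le> C * exp ((h + h / 2) * n)"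
      using h(3)[of "h / 2"] by auto
    then show ?thesis using limit_positive_entropy[OF fin \<open>h > 0\<close> h(2)] by blast
  qed
qed

end
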